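(* Let $S$ be a numerical semigroup. If $\mathrm{Ap}(S)$ is $\gamma$-rectangular, then $S$ is free. The converse fails: $S=\langle 5,6,9\rangle$ is free but its Apéry set is not $\gamma$-rectangular.
   Context: A numerical semigroup is a submonoid $S$ of $(\mathbb N,+)$ with finite complement in $\mathbb N$; $g_1<\dots<g_\nu$ is its minimal system of generators, $m=g_1$, and for $n\in S$, $\mathrm{Ap}(S,n)=\{s\in S: s-n\notin S\}$, $\mathrm{Ap}(S)=\mathrm{Ap}(S,m)$. A representation of $s\in S$ is an expression $s=\sum_{i=1}^\nu\lambda_ig_i$, $\lambda_i\in\mathbb N$; $\mathrm{ord}(s)$ is the maximum of $\sum\lambda_i$ over all representations; a representation is maximal if $\sum\lambda_i=\mathrm{ord}(s)$. For $i=2,\dots,\nu$, $\gamma_i=\max\{h\in\mathbb N: hg_i\in\mathrm{Ap}(S),\ \mathrm{ord}(hg_i)=h,\ hg_i\text{ has a unique maximal representation}\}$; $\mathrm{Ap}(S)$ is $\gamma$-rectangular if $\mathrm{Ap}(S)=\{\sum_{i=2}^\nu\lambda_ig_i: 0\le\lambda_i\le\gamma_i\}$. For an arbitrary ordering $\mathbf n=(n_1,\dots,n_\nu)$ of the minimal generators, $\phi_i=\min\{h\in\mathbb N: hn_i\in\langle n_1,\dots,n_{i-1}\rangle\}-1$ ($i=2,\dots,\nu$). $S$ is free if there is such an ordering with $\mathrm{Ap}(S,n_1)=\{\sum_{i=2}^\nu\lambda_in_i: 0\le\lambda_i\le\phi_i\}$. *)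

theory Defs
  imports Main
begin

definition numerical_semigroup :: "nat set \<Rightarrow> bool" where
  "numerical_semigroup S \<longleftrightarrow> 0 \<in> S \<and> (\<forall>a\<in>S. \<forall>b\<in>S. a + b \<in> S) \<and> finite (UNIV - S)"

definition gen_by :: "nat set \<Rightarrow> nat set" where
  "gen_by A = {s. \<exists>f. s = (\<Sum>a\<in>A. f a * a)}"

definition mingens :: "nat set \<Rightarrow> nat set" where
  "mingens S = {x \<in> S. x \<noteq> 0 \<and> \<not> (\<exists>a\<in>S. \<exists>b\<in>S. a \<noteq> 0 \<and> b \<noteq> 0 \<and> x = a + b)}"

definition mult :: "nat set \<Rightarrow> nat" where
  "mult S = Min (mingens S)"

text \<open>Apery set Ap(S,n) = {s in S. s - n notin S} (s - n taken in the integers).\<close>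
definition Apery :: "nat set \<Rightarrow> nat \<Rightarrow> nat set" where
  "Apery S n = {s \<in> S. \<not> (n \<le> s \<and> s - n \<in> S)}"

definition Ap :: "nat set \<Rightarrow> nat set" where
  "Ap S = Apery S (mult S)"

definition is_rep :: "nat set \<Rightarrow> nat \<Rightarrow> (nat \<Rightarrow> nat) \<Rightarrow> bool" where
  "is_rep S s f \<longleftrightarrow> (\<forall>x. x \<notin> mingens S \<longrightarrow> f x = 0) \<and> s = (\<Sum>g\<in>mingens S. f g * g)"

definition ord :: "nat set \<Rightarrow> nat \<Rightarrow> nat" where
  "ord S s = Max {(\<Sum>g\<in>mingens S. f g) | f. is_rep S s f}"

definition is_maxrep :: "nat set \<Rightarrow> nat \<Rightarrow> (nat \<Rightarrow> nat) \<Rightarrow> bool" where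
  "is_maxrep S s f \<longleftrightarrow> is_rep S s f \<and> (\<Sum>g\<in>mingens S. f g) = ord S s"

definition gamma :: "nat set \<Rightarrow> nat \<Rightarrow> nat" where
  "gamma S g = Max {h. h * g \<in> Ap S \<and> ord S (h * g) = h \<and> (\<exists>!f. is_maxrep S (h * g) f)}"

definition gamma_rectangular :: "nat set \<Rightarrow> bool" where
  "gamma_rectangular S \<longleftrightarrow>
     Ap S = {(\<Sum>g\<in>mingens S - {mult S}. l g * g) | l.
               \<forall>g\<in>mingens S - {mult S}. l g \<le> gamma S g}"

text \<open>For an ordering ns = [n_1,...,n_nu] (0-based list), phi for position i (i >= 1):
  min{h > 0. h * n_i in <n_1,...,n_(i-1)>} - 1.\<close>
definition phi :: "nat list \<Rightarrow> nat \<Rightarrow> nat" where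
  "phi ns i = (LEAST h. h > 0 \<and> h * ns ! i \<in> gen_by (set (take i ns))) - 1"

definition free :: "nat set \<Rightarrow> bool" where
  "free S \<longleftrightarrow> (\<exists>ns. distinct ns \<and> set ns = mingens S \<and>
     Apery S (ns ! 0) = {(\<Sum>i\<in>{1..<length ns}. l i * ns ! i) | l.
                          \<forall>i\<in>{1..<length ns}. l i \<le> phi ns i})"

end

theory Submission
  imports Defs Complex_Main "HOL-Library.FuncSet"
begin

text \<open>
  Any representation of an Apery element with a coefficient above \<open>\<gamma>\<^sub>i\<close> can be replaced by a strictly
  heavier one for a suitable additive weight. In the \<open>\<gamma>\<close>-rectangular case this forces the box sums to be
  pairwise distinct, so the box is a system of representatives modulo \<open>m\<close>. Evaluating the
  resulting product of geometric sums at a primitive \<open>d\<close>-th root of unity, where \<open>d\<close> is the gcd of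
  the generators already chosen (initially \<open>m\<close> alone), yields a next generator \<open>g\<^sub>i\<close> with
  \<open>d\<close> dividing \<open>(\<gamma>\<^sub>i + 1) g\<^sub>i\<close>. As the face of the box spanned by the chosen generators represents all
  multiples of \<open>d\<close>, and box sums are least in their classes, \<open>(\<gamma>\<^sub>i + 1) g\<^sub>i\<close> lies in the semigroup of the
  chosen generators. Thus \<open>\<phi>\<^sub>i \<le> \<gamma>\<^sub>i\<close> for the ordering so obtained, whereas the Apery set is always
  contained in the \<open>\<phi>\<close>-box.
\<close>

section \<open>Generated semigroups and sums with natural coefficients\<close>

lemma gen_byI: "(\<Sum>a\<in>A. f a * a) \<in> gen_by A"
  unfolding gen_by_def by blast

lemma gen_by_zero: "0 \<in> gen_by A"
  using gen_byI[of "\<lambda>_. 0" A] by simp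

lemma gen_by_add: "x \<in> gen_by A \<Longrightarrow> y \<in> gen_by A \<Longrightarrow> x + y \<in> gen_by A"
proof -
  assume "x \<in> gen_by A" "y \<in> gen_by A"
  then obtain f h where "x = (\<Sum>a\<in>A. f a * a)" "y = (\<Sum>a\<in>A. h a * a)"
    unfolding gen_by_def by blast
  then have "x + y = (\<Sum>a\<in>A. (f a + h a) * a)"
    by (simp add: sum.distrib algebra_simps)
  then show ?thesis using gen_byI by metis
qed

lemma gen_by_mult: "x \<in> gen_by A \<Longrightarrow> k * x \<in> gen_by A"
  by (induction k) (auto simp: gen_by_zero intro: gen_by_add)

lemma gen_by_insert:
  assumes "finite A" "a \<notin> A"
  shows "x \<in> gen_by (insert a A) \<longleftrightarrow> (\<exists>k. \<exists>y\<in>gen_by A. x = k * a + y)"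
proof
  assume "x \<in> gen_by (insert a A)"
  then obtain f where "x = (\<Sum>b\<in>insert a A. f b * b)" unfolding gen_by_def by blast
  then have "x = f a * a + (\<Sum>b\<in>A. f b * b)" using assms by simp
  then show "\<exists>k. \<exists>y\<in>gen_by A. x = k * a + y" using gen_byI by blast
next
  assume "\<exists>k. \<exists>y\<in>gen_by A. x = k * a + y"
  then obtain k f where x: "x = k * a + (\<Sum>b\<in>A. f b * b)" unfolding gen_by_def by blast
  have "(\<Sum>b\<in>insert a A. (f(a := k)) b * b) = k * a + (\<Sum>b\<in>A. (f(a := k)) b * b)"
    using assms by simp
  also have "(\<Sum>b\<in>A. (f(a := k)) b * b) = (\<Sum>b\<in>A. f b * b)"
    using assms by (intro sum.cong) auto
  finally show "x \<in> gen_by (insert a A)" using x gen_byI by metis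
qed

lemma gen_by_base:
  assumes "finite A" "a \<in> A"
  shows "a \<in> gen_by A"
proof -
  have "(\<Sum>b\<in>A. (if b = a then 1 else 0) * b) = a"
    using assms by (simp add: if_distrib[of "\<lambda>x. x * _"] sum.delta cong: if_cong)
  then show ?thesis using gen_byI by metis
qed

text \<open>Removes \<open>k\<close> copies of \<open>a\<close>. The valuation \<open>v\<close> is
  arbitrary, so one split serves both the value and the weight of a representation.\<close>

lemma sum_split_multiple:
  fixes v :: "'a \<Rightarrow> nat"
  assumes "finite A" "a \<in> A" "k \<le> f a"
  shows "(\<Sum>b\<in>A. f b * v b) = (\<Sum>b\<in>A. (f b - (if b = a then k else 0)) * v b) + k * v a"
proof -
  have "(\<Sum>b\<in>A. f b * v b)
      = (\<Sum>b\<in>A. (f b - (if b = a then k else 0)) * v b + (if b = a then k * v b else 0))"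
    using assms by (intro sum.cong) (auto simp: algebra_simps diff_mult_distrib)
  also have "\<dots> = (\<Sum>b\<in>A. (f b - (if b = a then k else 0)) * v b) + k * v a"
    using assms by (simp add: sum.distrib sum.delta)
  finally show ?thesis .
qed

lemma sum_single:
  fixes v :: "'a \<Rightarrow> nat"
  assumes "finite A" "a \<in> A"
  shows "(\<Sum>b\<in>A. (if b = a then k else 0) * v b) = k * v a"
  using assms by (simp add: if_distrib[of "\<lambda>x. x * _"] sum.delta cong: if_cong)

lemma weighted_sum_le_eqD:
  fixes f h :: "nat \<Rightarrow> nat"
  assumes "finite A" "\<And>a. a \<in> A \<Longrightarrow> f a \<le> h a" "\<And>a. a \<in> A \<Longrightarrow> 0 < a"
    "(\<Sum>a\<in>A. f a * a) = (\<Sum>a\<in>A. h a * a)" "a \<in> A"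
  shows "f a = h a"
proof (rule ccontr)
  assume "f a \<noteq> h a"
  then have "f a * a < h a * a" using assms(2,3,5) by (simp add: le_neq_trans)
  then have "(\<Sum>a\<in>A. f a * a) < (\<Sum>a\<in>A. h a * a)"
    using assms by (intro sum_strict_mono_ex1) auto
  then show False using assms by simp
qed

section \<open>Factorisations of cyclic groups into arithmetic progressions\<close>

lemma cis_root_eq_1_iff:
  assumes "d > 0"
  shows "cis (2 * pi / real d) ^ k = 1 \<longleftrightarrow> d dvd k"
proof -
  have *: "cis (2 * pi / real d) ^ k = cis (2 * pi * (real k / real d))"
    by (simp add: DeMoivre algebra_simps)
  have int: "cis (2 * pi * t) = 1 \<longleftrightarrow> (\<exists>n::int. t = n)" for t
  proof
    assume "cis (2 * pi * t) = 1"
    then have "cos (2 * pi * t) = 1" by (metis cis.sel(1) one_complex.sel(1))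
    then obtain n :: int where "2 * pi * t = n * 2 * pi" using cos_one_2pi_int by auto
    then show "\<exists>n::int. t = n" by auto
  next
    assume "\<exists>n::int. t = n"
    then show "cis (2 * pi * t) = 1" using cis_multiple_2pi by auto
  qed
  have "cis (2 * pi / real d) ^ k = 1 \<longleftrightarrow> (\<exists>n::int. real k / real d = n)"
    unfolding * by (rule int)
  also have "\<dots> \<longleftrightarrow> d dvd k"
  proof
    assume "\<exists>n::int. real k / real d = n"
    then obtain n :: int where "real k / real d = n" by blast
    then have "real k = real_of_int n * real d" using assms by (simp add: field_simps)
    then have "int k = n * int d" by (metis of_int_eq_iff of_int_mult of_int_of_nat_eq)
    then show "d dvd k" by (metis dvd_triv_right int_dvd_int_iff)
  next
    assume "d dvd k"
    then obtain n where "k = d * n" by blast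
    then have "real k / real d = of_int (int n)" using assms by simp
    then show "\<exists>n::int. real k / real d = n" by blast
  qed
  finally show ?thesis .
qed

text \<open>Hajos' theorem for cyclic groups: a character with kernel generated by \<open>d\<close> annihilates the
  sum over the whole group, hence one factor of the corresponding product of geometric sums.\<close>

lemma cyclic_factorisation:
  fixes c :: "nat \<Rightarrow> nat"
  assumes fin: "finite A" and m: "m > 0" and d: "d dvd m" "d > 1"
    and bij: "bij_betw (\<lambda>l. (\<Sum>a\<in>A. l a * a) mod m) (PiE A (\<lambda>a. {..c a})) {..<m}"
  shows "\<exists>a\<in>A. \<not> d dvd a \<and> d dvd (c a + 1) * a"
proof -
  define z where "z = cis (2 * pi / real d)"
  have z: "z ^ k = 1 \<longleftrightarrow> d dvd k" for k
    unfolding z_def using d by (intro cis_root_eq_1_iff) simp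
  have zm: "z ^ m = 1" using z d by simp
  have z1: "z \<noteq> 1" using z[of 1] d by simp
  have zmod: "z ^ (k mod m) = z ^ k" for k
  proof -
    have "z ^ k = z ^ (m * (k div m) + k mod m)" by simp
    also have "\<dots> = z ^ (k mod m)" by (simp only: power_add power_mult zm) simp
    finally show ?thesis by simp
  qed
  have "(\<Prod>a\<in>A. \<Sum>h\<le>c a. (z ^ a) ^ h)
      = (\<Sum>l\<in>PiE A (\<lambda>a. {..c a}). \<Prod>a\<in>A. (z ^ a) ^ l a)"
    using fin by (intro prod_sum_PiE) auto
  also have "\<dots> = (\<Sum>l\<in>PiE A (\<lambda>a. {..c a}). z ^ ((\<Sum>a\<in>A. l a * a) mod m))"
    by (simp add: zmod power_sum power_mult[symmetric] mult.commute)
  also have "\<dots> = (\<Sum>r<m. z ^ r)"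
    by (rule sum.reindex_bij_betw[OF bij])
  also have "\<dots> = 0" using z1 zm by (simp add: sum_gp_strict)
  finally obtain a where a: "a \<in> A" "(\<Sum>h\<le>c a. (z ^ a) ^ h) = 0"
    using fin by (auto simp: prod_zero_iff)
  \<comment> \<open>Otherwise the vanishing factor would be the number
    \<open>c a + 1\<close>.\<close>
  have "z ^ a \<noteq> 1"
  proof
    assume "z ^ a = 1"
    then have "of_nat (Suc (c a)) = (0::complex)" using a(2) by simp
    then show False by (simp only: of_nat_eq_0_iff)
  qed
  moreover have "(z ^ a) ^ (c a + 1) = 1"
    using one_diff_power_eq[of "z ^ a" "Suc (c a)"] a(2) by (simp add: lessThan_Suc_atMost)
  then have "z ^ ((c a + 1) * a) = 1" by (metis power_mult mult.commute)
  ultimately show ?thesis using z a(1) by blast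
qed

section \<open>Apery sets and representations\<close>

locale numsgp =
  fixes S :: "nat set"
  assumes numerical_semigroup: "numerical_semigroup S"
begin

abbreviation "M \<equiv> mingens S"
abbreviation "m \<equiv> mult S"

lemma zero_mem: "0 \<in> S" and add_mem: "a \<in> S \<Longrightarrow> b \<in> S \<Longrightarrow> a + b \<in> S"
  using numerical_semigroup unfolding numerical_semigroup_def by auto

lemma mult_mem: "a \<in> S \<Longrightarrow> k * a \<in> S"
  by (induction k) (auto simp: zero_mem intro: add_mem)

lemma sum_mem: "(\<And>a. a \<in> A \<Longrightarrow> a \<in> S) \<Longrightarrow> (\<Sum>a\<in>A. f a * a) \<in> S"
  by (induction A rule: infinite_finite_induct) (auto simp: zero_mem intro: add_mem mult_mem)

lemma ex_conductor: "\<exists>N. \<forall>x\<ge>N. x \<in> S"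
proof -
  have "finite (UNIV - S)" using numerical_semigroup unfolding numerical_semigroup_def by auto
  then obtain N where "\<forall>x\<in>UNIV - S. x < N" using finite_nat_set_iff_bounded by blast
  then show ?thesis by (metis DiffI UNIV_I not_less)
qed

lemma sum_notin_mingens: "a \<in> S \<Longrightarrow> b \<in> S \<Longrightarrow> a \<noteq> 0 \<Longrightarrow> b \<noteq> 0 \<Longrightarrow> a + b \<notin> M"
  unfolding mingens_def by auto

lemma finite_mingens: "finite M"
proof -
  obtain N where N: "\<forall>x\<ge>N. x \<in> S" using ex_conductor by blast
  have "x \<le> 2 * N + 2" if "x \<in> M" for x
  proof (rule ccontr)
    assume "\<not> x \<le> 2 * N + 2"
    then show False using sum_notin_mingens[of "N + 1" "x - (N + 1)"] N that by simp
  qed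
  then show ?thesis using finite_nat_set_iff_bounded_le by blast
qed

lemma mingens_mem: "a \<in> M \<Longrightarrow> a \<in> S" and mingens_pos: "a \<in> M \<Longrightarrow> 0 < a"
  unfolding mingens_def by auto

lemma mingens_nonempty: "M \<noteq> {}"
proof -
  obtain N where N: "\<forall>x\<ge>N. x \<in> S" using ex_conductor by blast
  define x where "x = (LEAST x. x \<in> S \<and> x \<noteq> 0)"
  have x: "x \<in> S \<and> x \<noteq> 0" unfolding x_def by (rule LeastI[of _ "Suc N"]) (use N in auto)
  have "x \<le> y" if "y \<in> S" "y \<noteq> 0" for y unfolding x_def using that by (intro Least_le) auto
  then have "x \<in> M" using x unfolding mingens_def by fastforce
  then show ?thesis by blast
qed

lemma mult_mingens: "m \<in> M"
  unfolding mult_def using finite_mingens mingens_nonempty by (rule Min_in)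

lemma mult_pos: "0 < m" using mult_mingens mingens_pos by blast

lemma ex_rep: "x \<in> S \<Longrightarrow> x \<in> gen_by M"
proof (induction x rule: less_induct)
  case (less x)
  show ?case
  proof (cases "x = 0 \<or> x \<in> M")
    case True
    then show ?thesis using gen_by_zero gen_by_base finite_mingens by auto
  next
    case False
    then obtain a b where "a \<in> S" "b \<in> S" "a \<noteq> 0" "b \<noteq> 0" "x = a + b"
      using less.prems unfolding mingens_def by blast
    then show ?thesis using less.IH[of a] less.IH[of b] gen_by_add by auto
  qed
qed

section \<open>Apery elements as least elements of classes modulo \<open>m\<close>\<close>

lemma Ap_mem: "w \<in> Ap S \<Longrightarrow> w \<in> S"
  unfolding Ap_def Apery_def by blast

lemma Ap_down:
  assumes "x + y \<in> Ap S" "x \<in> S" "y \<in> S"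
  shows "x \<in> Ap S"
proof -
  have "x + y - m \<in> S" if "m \<le> x" "x - m \<in> S"
    using add_mem[OF that(2) assms(3)] that(1) by simp
  then show ?thesis using assms unfolding Ap_def Apery_def by auto
qed

lemma not_in_Ap: "x \<in> S \<Longrightarrow> m + x \<notin> Ap S"
  unfolding Ap_def Apery_def by auto

text \<open>A smaller \<open>x\<close> in the class of \<open>w\<close> would reach \<open>w\<close>
  by adding \<open>m\<close> at least once, which would put \<open>w - m\<close> into
  \<open>S\<close>.\<close>

lemma Ap_min:
  assumes "w \<in> Ap S" "x \<in> S" "x mod m = w mod m"
  shows "\<exists>k. x = w + k * m"
proof (cases "w \<le> x")
  case True
  then show ?thesis using assms(3)
    by (metis mod_eq_dvd_iff_nat dvd_def le_add_diff_inverse mult.commute)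
next
  case False
  then have "m dvd w - x" using assms(3) by (metis mod_eq_dvd_iff_nat nat_le_linear)
  then obtain k where k: "w - x = m * k" by blast
  then obtain j where "k = Suc j" using False by (cases k) auto
  then have "w = m + (j * m + x)" using k False by (simp add: mult.commute)
  moreover have "j * m + x \<in> S" using assms(2) mult_mingens mingens_mem mult_mem add_mem by blast
  ultimately show ?thesis using assms(1) not_in_Ap by metis
qed

lemma Ap_inj:
  assumes "w \<in> Ap S" "x \<in> Ap S" "x mod m = w mod m"
  shows "x = w"
  using Ap_min[of w x] Ap_min[of x w] assms Ap_mem by fastforce

lemma ex_Ap: "\<exists>w\<in>Ap S. w mod m = r mod m"
proof -
  obtain N where N: "\<forall>x\<ge>N. x \<in> S" using ex_conductor by blast
  have "r + N * m \<ge> N" using mult_pos by (simp add: trans_le_add2)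
  then have ex: "r + N * m \<in> S \<and> (r + N * m) mod m = r mod m" using N by simp
  define w where "w = (LEAST w. w \<in> S \<and> w mod m = r mod m)"
  have w: "w \<in> S \<and> w mod m = r mod m" unfolding w_def 
    using LeastI[of "\<lambda>w. w \<in> S \<and> w mod m = r mod m", OF ex] .
  have min: "w \<le> y" if "y \<in> S" "y mod m = r mod m" for y
    unfolding w_def using that by (intro Least_le) auto
  have "\<not> (m \<le> w \<and> w - m \<in> S)"
  proof
    assume a: "m \<le> w \<and> w - m \<in> S"
    then have "(w - m) mod m = r mod m" using w by (metis le_mod_geq)
    then have "w \<le> w - m" using min a by blast
    then show False using a mult_pos by linarith
  qed
  then show ?thesis using w unfolding Ap_def Apery_def by auto
qed

text \<open>Beyond \<open>N + m\<close>, subtracting \<open>m\<close> stays in \<open>S\<close>. The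
  bound makes the set under \<open>Max\<close> in \<open>gamma\<close> finite.\<close>

lemma Ap_bounded: "\<exists>B. \<forall>w\<in>Ap S. w \<le> B"
proof -
  obtain N where N: "\<forall>x\<ge>N. x \<in> S" using ex_conductor by blast
  have "w \<le> N + m" if "w \<in> Ap S" for w
  proof (rule ccontr)
    assume "\<not> w \<le> N + m"
    then have "w - m \<in> S" "w = m + (w - m)" using N by auto
    then show False using not_in_Ap that by metis
  qed
  then show ?thesis by blast
qed

section \<open>Degrees of representations, order and \<open>gamma\<close>\<close>

lemma degree_le:
  assumes "is_rep S s f"
  shows "(\<Sum>a\<in>M. f a) \<le> s"
proof -
  have "(\<Sum>a\<in>M. f a) \<le> (\<Sum>a\<in>M. f a * a)" using mingens_pos by (intro sum_mono) (auto simp: Suc_le_eq)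
  then show ?thesis using assms unfolding is_rep_def by simp
qed

lemma finite_degrees: "finite {(\<Sum>a\<in>M. f a) |f. is_rep S s f}"
  by (rule finite_subset[of _ "{..s}"]) (auto dest: degree_le)

lemma degree_le_ord: "is_rep S s f \<Longrightarrow> (\<Sum>a\<in>M. f a) \<le> ord S s"
  unfolding ord_def using finite_degrees by (intro Max_ge) auto

lemma ex_maxrep: "is_rep S s f \<Longrightarrow> \<exists>f. is_maxrep S s f"
proof -
  assume "is_rep S s f"
  then have "ord S s \<in> {(\<Sum>a\<in>M. f a) |f. is_rep S s f}"
    unfolding ord_def using finite_degrees by (intro Max_in) auto
  then show ?thesis unfolding is_maxrep_def by auto
qed

lemma is_rep_single: "a \<in> M \<Longrightarrow> is_rep S (h * a) (\<lambda>x. if x = a then h else 0)"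
  unfolding is_rep_def using finite_mingens sum_single[of M a h "\<lambda>x. x"] by auto

lemma degree_single: "a \<in> M \<Longrightarrow> (\<Sum>x\<in>M. if x = a then h else 0) = (h :: nat)"
  using finite_mingens by (simp add: sum.delta)

lemma finite_gamma_set:
  assumes "a \<in> M"
  shows "finite {h. h * a \<in> Ap S \<and> ord S (h * a) = h \<and> (\<exists>!f. is_maxrep S (h * a) f)}"
proof -
  obtain B where B: "\<forall>w\<in>Ap S. w \<le> B" using Ap_bounded by blast
  have "h \<le> B" if "h * a \<in> Ap S" for h
  proof -
    have "h \<le> h * a" using mingens_pos[OF assms] by simp
    then show ?thesis using B that by (meson order_trans)
  qed
  then have "{h. h * a \<in> Ap S \<and> ord S (h * a) = h \<and> (\<exists>!f. is_maxrep S (h * a) f)} \<subseteq> {..B}"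
    by blast
  then show ?thesis using finite_subset by blast
qed

lemma le_gamma:
  assumes "a \<in> M" "h * a \<in> Ap S" "ord S (h * a) = h" "\<exists>!f. is_maxrep S (h * a) f"
  shows "h \<le> gamma S a"
  unfolding gamma_def using finite_gamma_set[OF assms(1)] assms by (intro Max_ge) auto

text \<open>Beyond \<open>gamma S a\<close>, either the order of \<open>h * a\<close> exceeds
  \<open>h\<close> or its maximal representation is not unique. Both give a competitor to the pure
  representation of at least its degree.\<close>

lemma ex_other_rep:
  assumes a: "a \<in> M" and h: "gamma S a < h" "h * a \<in> Ap S"
  shows "\<exists>f. is_rep S (h * a) f \<and> f \<noteq> (\<lambda>x. if x = a then h else 0) \<and> h \<le> (\<Sum>x\<in>M. f x)"
proof -
  let ?e = "\<lambda>x. if x = a then h else 0"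
  have rep: "is_rep S (h * a) ?e" using is_rep_single[OF a] .
  obtain f where f: "is_maxrep S (h * a) f" using ex_maxrep rep by blast
  have ord: "h \<le> ord S (h * a)" using degree_le_ord[OF rep] degree_single[OF a, of h] by linarith
  show ?thesis
  proof (cases "f = ?e")
    case True
    have "(\<Sum>x\<in>M. f x) = ord S (h * a)" using f unfolding is_maxrep_def by blast
    then have "ord S (h * a) = h" using degree_single[OF a, of h] unfolding True by linarith
    then obtain f' where "is_maxrep S (h * a) f'" "f' \<noteq> f"
      using le_gamma[OF a h(2)] h(1) f by (metis not_less)
    then show ?thesis using True ord unfolding is_maxrep_def by auto
  next
    case False
    then show ?thesis using f ord unfolding is_maxrep_def by auto
  qed
qed

text \<open>With the weight \<open>C + x\<^sup>2\<close>, \<open>C\<close> large, representations are compared by degree first and then by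
  second moment; for given degree and sum the latter is minimal (strict convexity) exactly when only
  one generator occurs.\<close>

lemma ex_weight:
  "\<exists>v. \<forall>a\<in>M. (gamma S a + 1) * a \<in> Ap S \<longrightarrow>
     (\<exists>f. (\<Sum>x\<in>M. f x * x) = (gamma S a + 1) * a \<and> (gamma S a + 1) * v a < (\<Sum>x\<in>M. f x * v x))"
proof -
  \<comment> \<open>\<open>C\<close> is so large that one extra unit of degree outweighs the second
    moment of any of the pure representations compared.\<close>
  define C where "C = 1 + (\<Sum>a\<in>M. (gamma S a + 1) * a\<^sup>2)"
  have C: "(gamma S a + 1) * a\<^sup>2 < C" if "a \<in> M" for a
    unfolding C_def using member_le_sum[of a M "\<lambda>a. (gamma S a + 1) * a\<^sup>2"] that finite_mingens by simp
  define v where "v x = C + x\<^sup>2" for x :: nat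
  have "\<exists>f. (\<Sum>x\<in>M. f x * x) = (gamma S a + 1) * a \<and> (gamma S a + 1) * v a < (\<Sum>x\<in>M. f x * v x)"
    if a: "a \<in> M" and ap: "(gamma S a + 1) * a \<in> Ap S" for a
  proof -
    define h where "h = gamma S a + 1"
    obtain f where f: "is_rep S (h * a) f" "f \<noteq> (\<lambda>x. if x = a then h else 0)" "h \<le> (\<Sum>x\<in>M. f x)"
      using ex_other_rep[OF a, of h] ap unfolding h_def by auto
    have s: "(\<Sum>x\<in>M. f x * x) = h * a" using f(1) unfolding is_rep_def by simp
    have v: "(\<Sum>x\<in>M. f x * v x) = C * (\<Sum>x\<in>M. f x) + (\<Sum>x\<in>M. f x * x\<^sup>2)"
      unfolding v_def by (simp add: algebra_simps sum.distrib sum_distrib_left)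
    have "h * v a < (\<Sum>x\<in>M. f x * v x)"
    proof (cases "(\<Sum>x\<in>M. f x) = h")
      case True
      have "\<exists>b\<in>M. b \<noteq> a \<and> 0 < f b"
      proof (rule ccontr)
        assume "\<not> (\<exists>b\<in>M. b \<noteq> a \<and> 0 < f b)"
        then have z: "\<forall>b. b \<noteq> a \<longrightarrow> f b = 0" using f(1) unfolding is_rep_def by auto
        then have "(\<Sum>x\<in>M. f x) = (\<Sum>x\<in>M. if x = a then f a else 0)" by (intro sum.cong) auto
        then have "f a = h" using True degree_single[OF a, of "f a"] by linarith
        then show False using z f(2) by auto
      qed
      then obtain b where b: "b \<in> M" "b \<noteq> a" "0 < f b" by blast
      \<comment> \<open>With degree \<open>h\<close> and value \<open>h * a\<close> fixed, the
        squared deviations from \<open>a\<close> add up to the second moment minus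
        \<open>h * a^2\<close>.\<close>
      have "0 < (\<Sum>x\<in>M. int (f x) * (int x - int a)\<^sup>2)"
        using b finite_mingens by (intro sum_pos2[of _ b]) auto
      also have "\<dots> = (\<Sum>x\<in>M. int (f x * x\<^sup>2)) - 2 * int a * (\<Sum>x\<in>M. int (f x * x)) + (int a)\<^sup>2 * (\<Sum>x\<in>M. int (f x))"
        by (simp add: power2_eq_square algebra_simps sum.distrib sum_subtractf sum_distrib_left)
      also have "\<dots> = int (\<Sum>x\<in>M. f x * x\<^sup>2) - 2 * int a * int (h * a) + (int a)\<^sup>2 * int h"
        by (simp only: of_nat_sum[symmetric] s True)
      also have "\<dots> = int (\<Sum>x\<in>M. f x * x\<^sup>2) - int (h * a\<^sup>2)" by (simp add: power2_eq_square)
      finally have "h * a\<^sup>2 < (\<Sum>x\<in>M. f x * x\<^sup>2)" by linarith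
      then show ?thesis unfolding v True by (simp add: v_def algebra_simps)
    next
      case False
      then have "h + 1 \<le> (\<Sum>x\<in>M. f x)" using f(3) by simp
      then have "C * (h + 1) \<le> C * (\<Sum>x\<in>M. f x)" by (rule mult_le_mono2)
      then show ?thesis unfolding v using C[OF a] by (simp add: v_def h_def algebra_simps)
    qed
    then show ?thesis using s unfolding h_def by blast
  qed
  then show ?thesis by blast
qed

end

section \<open>Rectangular Apery sets\<close>

locale rectangular = numsgp +
  assumes rectangular: "gamma_rectangular S"
begin

text \<open>Side lengths of the box, set to \<open>0\<close> at \<open>m\<close> so that boxes and
  representations share the index set \<open>M\<close>.\<close>

definition c :: "nat \<Rightarrow> nat" where
  "c a = (if a = m then 0 else gamma S a)"

lemma Ap_box: "Ap S = {(\<Sum>a\<in>M. l a * a) |l. \<forall>a\<in>M. l a \<le> c a}"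
proof -
  have rest: "(\<Sum>a\<in>M. l a * a) = (\<Sum>a\<in>M - {m}. l a * a)" if "l m = 0" for l
    using that finite_mingens mult_mingens by (simp add: sum.remove)
  show ?thesis
  proof (intro equalityI subsetI)
    fix x assume "x \<in> Ap S"
    then obtain l where l: "x = (\<Sum>a\<in>M - {m}. l a * a)" "\<forall>a\<in>M - {m}. l a \<le> gamma S a"
      using rectangular unfolding gamma_rectangular_def by auto
    have "x = (\<Sum>a\<in>M. (l(m := 0)) a * a)"
      using l(1) rest[of "l(m := 0)"] by (auto intro!: sum.cong)
    moreover have "\<forall>a\<in>M. (l(m := 0)) a \<le> c a" using l(2) by (auto simp: c_def)
    ultimately show "x \<in> {(\<Sum>a\<in>M. l a * a) |l. \<forall>a\<in>M. l a \<le> c a}" by blast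
  next
    fix x assume "x \<in> {(\<Sum>a\<in>M. l a * a) |l. \<forall>a\<in>M. l a \<le> c a}"
    then obtain l where l: "x = (\<Sum>a\<in>M. l a * a)" "\<forall>a\<in>M. l a \<le> c a" by blast
    then have "l m = 0" using mult_mingens unfolding c_def by force
    then have "x = (\<Sum>a\<in>M - {m}. l a * a)" using l rest by simp
    moreover have "\<forall>a\<in>M - {m}. l a \<le> gamma S a"
      using l(2) unfolding c_def by (metis DiffE singletonI)
    ultimately show "x \<in> Ap S" using rectangular unfolding gamma_rectangular_def by blast
  qed
qed

lemma box_mem_Ap: "(\<And>a. a \<in> M \<Longrightarrow> l a \<le> c a) \<Longrightarrow> (\<Sum>a\<in>M. l a * a) \<in> Ap S"
  using Ap_box by blast

text \<open>The corner \<open>c\<close> is the unique heaviest representation of its sum, since any representation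
  leaving the box can be made heavier. Exchanging \<open>l\<close> for \<open>l'\<close> in the corner then shows \<open>l = l'\<close>.\<close>

lemma box_inj:
  assumes l: "\<And>a. a \<in> M \<Longrightarrow> l a \<le> c a" and l': "\<And>a. a \<in> M \<Longrightarrow> l' a \<le> c a"
    and eq: "(\<Sum>a\<in>M. l a * a) = (\<Sum>a\<in>M. l' a * a)" and b: "b \<in> M"
  shows "l b = l' b"
proof -
  obtain v where v: "\<forall>a\<in>M. (gamma S a + 1) * a \<in> Ap S \<longrightarrow>
     (\<exists>f. (\<Sum>x\<in>M. f x * x) = (gamma S a + 1) * a \<and> (gamma S a + 1) * v a < (\<Sum>x\<in>M. f x * v x))"
    using ex_weight by blast
  define om where "om = (\<Sum>a\<in>M. c a * a)"
  have om: "om \<in> Ap S" unfolding om_def by (rule box_mem_Ap) simp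
  define R where "R f \<longleftrightarrow> (\<Sum>a\<in>M. f a * a) = om" for f :: "nat \<Rightarrow> nat"
  define W where "W f = (\<Sum>a\<in>M. f a * v a)" for f :: "nat \<Rightarrow> nat"
  \<comment> \<open>If a coordinate \<open>x\<close> exceeds \<open>c x\<close>, then
    \<open>c x + 1\<close> copies of \<open>x\<close> can be exchanged for a heavier combination. So
    a heaviest representation lies in the box, below the corner with equal sum, hence equals
    it.\<close>
  have heaviest: "f a = c a" if f: "R f" "\<And>f'. R f' \<Longrightarrow> W f' \<le> W f" and a: "a \<in> M" for f a
  proof -
    have "f x \<le> c x" if x: "x \<in> M" for x
    proof (rule ccontr)
      assume "\<not> f x \<le> c x"
      then have le: "c x + 1 \<le> f x" by simp
      define r where "r y = f y - (if y = x then c x + 1 else 0)" for y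
      have split: "(\<Sum>y\<in>M. f y * u y) = (\<Sum>y\<in>M. r y * u y) + (c x + 1) * u x" for u :: "nat \<Rightarrow> nat"
        unfolding r_def using finite_mingens x le by (rule sum_split_multiple)
      have "(c x + 1) * x + (\<Sum>y\<in>M. r y * y) = om"
        using f(1) split[of "\<lambda>y. y"] unfolding R_def by simp
      then have "(c x + 1) * x + (\<Sum>y\<in>M. r y * y) \<in> Ap S" using om by (simp only:)
      moreover have "(c x + 1) * x \<in> S" using mult_mem mingens_mem x by blast
      moreover have "(\<Sum>y\<in>M. r y * y) \<in> S" using sum_mem mingens_mem by blast
      ultimately have ap: "(c x + 1) * x \<in> Ap S" by (rule Ap_down)
      \<comment> \<open>As \<open>c m = 0\<close>, the case \<open>x = m\<close> would make
        \<open>m\<close> an Apery element.\<close>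
      then have "x \<noteq> m" using not_in_Ap[OF zero_mem] unfolding c_def by auto
      then have cx: "c x = gamma S x" unfolding c_def by simp
      then obtain h where h: "(\<Sum>y\<in>M. h y * y) = (c x + 1) * x" "(c x + 1) * v x < (\<Sum>y\<in>M. h y * v y)"
        using v[rule_format, OF x] ap unfolding cx by blast
      have "R (\<lambda>y. r y + h y)"
        using f(1) split[of "\<lambda>y. y"] h(1) unfolding R_def
        by (simp add: distrib_right sum.distrib)
      moreover have "W f < W (\<lambda>y. r y + h y)"
        using split[of v] h(2) unfolding W_def by (simp add: distrib_right sum.distrib)
      ultimately show False using f(2) by (meson not_less)
    qed
    then show ?thesis
      using weighted_sum_le_eqD[OF finite_mingens, of f c a] mingens_pos f(1) a unfolding R_def om_def by blast
  qed
  \<comment> \<open>Coefficients of a representation of \<open>om\<close> are at most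
    \<open>om\<close>, so weights are bounded and a heaviest representation exists.\<close>
  have bound: "W f < om * (\<Sum>a\<in>M. v a) + 1" if "R f" for f
  proof -
    have "W f \<le> (\<Sum>a\<in>M. om * v a)" unfolding W_def
    proof (intro sum_mono mult_le_mono1)
      fix a assume a: "a \<in> M"
      have "f a \<le> f a * a" using mingens_pos[OF a] by simp
      also have "\<dots> \<le> om" using that finite_mingens a unfolding R_def
        by (auto intro!: member_le_sum[of a M "\<lambda>a. f a * a"])
      finally show "f a \<le> om" .
    qed
    then show ?thesis by (simp add: sum_distrib_left)
  qed
  have Rc: "R c" unfolding R_def om_def by simp
  obtain F where F: "R F" "\<And>f. R f \<Longrightarrow> W f \<le> W F"
    using ex_has_greatest_nat[of R c W "om * (\<Sum>a\<in>M. v a) + 1"] Rc bound by blast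
  then have "W F = W c" unfolding W_def using heaviest[OF F] by (intro sum.cong) auto
  then have c_max: "W f \<le> W c" if "R f" for f using F(2)[OF that] by simp
  have main: "k a = k' a"
    if k: "\<And>a. a \<in> M \<Longrightarrow> k a \<le> c a" and k_eq: "(\<Sum>a\<in>M. k a * a) = (\<Sum>a\<in>M. k' a * a)"
      and Wk: "W k \<le> W k'" and a: "a \<in> M" for k k' a
  proof -
    \<comment> \<open>The corner with \<open>k\<close> exchanged for \<open>k'\<close>: same sum, at
      least the same weight, hence again the corner.\<close>
    define f where "f y = (c y - k y) + k' y" for y
    have exch: "(\<Sum>y\<in>M. f y * u y) + (\<Sum>y\<in>M. k y * u y) = (\<Sum>y\<in>M. c y * u y) + (\<Sum>y\<in>M. k' y * u y)"
      for u :: "nat \<Rightarrow> nat"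
      unfolding sum.distrib[symmetric] f_def
    proof (intro sum.cong refl)
      fix y assume "y \<in> M"
      then have "c y = (c y - k y) + k y" using k by simp
      then have "c y * u y = (c y - k y) * u y + k y * u y" by (metis distrib_right)
      then show "(c y - k y + k' y) * u y + k y * u y = c y * u y + k' y * u y"
        by (simp add: distrib_right)
    qed
    have "R f" using exch[of "\<lambda>y. y"] k_eq unfolding R_def om_def by simp
    moreover have "W c \<le> W f" using exch[of v] Wk unfolding W_def by simp
    ultimately have "f a = c a" using heaviest[of f a] c_max a by (meson order_trans)
    then show ?thesis using k[OF a] unfolding f_def by simp
  qed
  \<comment> \<open>Weights are comparable, so \<open>main\<close> applies in one of the two
    orders.\<close>
  show ?thesis
    using main[of l l' b] main[of l' l b] l l' eq b by (metis linear)
qed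

section \<open>The box modulo \<open>m\<close>, its filled faces and the choice of the
  ordering\<close>

text \<open>Each class modulo \<open>m\<close> contains exactly one Apery element, which has exactly
  one coordinate vector in the box by \<open>box_inj\<close>.\<close>

lemma box_bij: "bij_betw (\<lambda>l. (\<Sum>a\<in>M. l a * a) mod m) (PiE M (\<lambda>a. {..c a})) {..<m}"
proof (rule bij_betw_imageI)
  show "inj_on (\<lambda>l. (\<Sum>a\<in>M. l a * a) mod m) (PiE M (\<lambda>a. {..c a}))"
  proof (rule inj_onI)
    fix l l' assume l: "l \<in> PiE M (\<lambda>a. {..c a})" "l' \<in> PiE M (\<lambda>a. {..c a})"
      and eq: "(\<Sum>a\<in>M. l a * a) mod m = (\<Sum>a\<in>M. l' a * a) mod m"
    have le: "l a \<le> c a" "l' a \<le> c a" if "a \<in> M" for a using l that by (auto dest: PiE_mem)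
    have "(\<Sum>a\<in>M. l a * a) \<in> Ap S" "(\<Sum>a\<in>M. l' a * a) \<in> Ap S"
      using le by (blast intro: box_mem_Ap)+
    then have "(\<Sum>a\<in>M. l a * a) = (\<Sum>a\<in>M. l' a * a)" using Ap_inj eq by blast
    then have "l a = l' a" if "a \<in> M" for a using box_inj[of l l' a] le that by blast
    then show "l = l'" using l by (intro PiE_ext) auto
  qed
  show "(\<lambda>l. (\<Sum>a\<in>M. l a * a) mod m) ` PiE M (\<lambda>a. {..c a}) = {..<m}"
  proof (intro equalityI subsetI)
    fix r assume "r \<in> {..<m}"
    then have r: "r mod m = r" by simp
    obtain w where "w \<in> Ap S" "w mod m = r" using ex_Ap[of r] r by auto
    then obtain l where l: "r = (\<Sum>a\<in>M. l a * a) mod m" "\<forall>a\<in>M. l a \<le> c a"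
      unfolding Ap_box by blast
    have "(\<Sum>a\<in>M. restrict l M a * a) = (\<Sum>a\<in>M. l a * a)" by (intro sum.cong) auto
    then have "r = (\<Sum>a\<in>M. restrict l M a * a) mod m" using l by simp
    moreover have "restrict l M \<in> PiE M (\<lambda>a. {..c a})" using l by auto
    ultimately show "r \<in> (\<lambda>l. (\<Sum>a\<in>M. l a * a) mod m) ` PiE M (\<lambda>a. {..c a})" by blast
  qed (use mult_pos in auto)
qed

text \<open>\<open>filled P\<close>: modulo \<open>m\<close>, the face of the box spanned by \<open>P\<close> covers the subgroup generated by \<open>P\<close>.\<close>

definition filled :: "nat set \<Rightarrow> bool" where
  "filled P \<longleftrightarrow> (\<forall>x. Gcd P dvd x \<longrightarrow>
     (\<exists>l. (\<forall>a\<in>P. l a \<le> c a) \<and> (\<Sum>a\<in>P. l a * a) mod m = x mod m))"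

lemma face_mem_Ap:
  assumes "P \<subseteq> M" "\<And>a. a \<in> P \<Longrightarrow> l a \<le> c a"
  shows "(\<Sum>a\<in>P. l a * a) \<in> Ap S"
proof -
  have "(\<Sum>a\<in>P. l a * a) = (\<Sum>a\<in>M. (if a \<in> P then l a else 0) * a)"
    using assms(1) finite_mingens by (intro sum.mono_neutral_cong_left) auto
  then show ?thesis using box_mem_Ap[of "\<lambda>a. if a \<in> P then l a else 0"] assms(2) by auto
qed

text \<open>A face sum is least in its class, so \<open>x\<close> differs from a congruent one by a
  multiple of \<open>m\<close>, itself in \<open>P\<close>. This turns divisibility by the gcd into
  membership.\<close>

lemma filled_mem_gen_by:
  assumes "P \<subseteq> M" "m \<in> P" "filled P" "x \<in> S" "Gcd P dvd x"
  shows "x \<in> gen_by P"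
proof -
  obtain l where l: "\<forall>a\<in>P. l a \<le> c a" "(\<Sum>a\<in>P. l a * a) mod m = x mod m"
    using assms(3,5) unfolding filled_def by blast
  then obtain k where "x = (\<Sum>a\<in>P. l a * a) + k * m"
    using Ap_min[OF face_mem_Ap[OF assms(1), of l] assms(4)] by auto
  moreover have "m \<in> gen_by P"
    using assms(1,2) finite_mingens finite_subset gen_by_base by blast
  ultimately show ?thesis using gen_byI gen_by_add gen_by_mult by metis
qed

text \<open>Modulo \<open>d = Gcd P\<close>, every multiple of \<open>gcd a d\<close> is a multiple
  of \<open>a\<close>, with multiplier at most \<open>c a\<close> because \<open>d\<close> divides
  \<open>(c a + 1) * a\<close>. Subtracting that multiple leaves a class modulo \<open>m\<close>
  covered by \<open>P\<close>.\<close>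

lemma filled_insert:
  assumes "P \<subseteq> M" "m \<in> P" "filled P" "a \<in> M - P" "Gcd P dvd (c a + 1) * a"
  shows "filled (insert a P)"
  unfolding filled_def
proof (intro allI impI)
  fix x assume x: "Gcd (insert a P) dvd x"
  define d where "d = Gcd P"
  have finP: "finite P" using assms(1) finite_mingens finite_subset by blast
  have dm: "d dvd m" unfolding d_def using assms(2) by (rule Gcd_dvd)
  then have d: "d > 0" using mult_pos by (auto intro: Nat.gr0I)
  have gd: "gcd a d dvd x" using x unfolding d_def by simp
  \<comment> \<open>Bezout gives \<open>x\<close> as \<open>k * u * a\<close> modulo
    \<open>d\<close>; the factor \<open>d - 1\<close> stands for \<open>-1\<close> within the
    naturals.\<close>
  have "\<exists>t. d dvd x + t * a"
  proof -
    have "a > 0" using assms(4) mingens_pos by blast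
    then obtain u v where uv: "a * u = d * v + gcd a d" using bezout_nat[of a d] by auto
    obtain k where k: "x = gcd a d * k" using gd by blast
    have ad: "a * u * (d - 1) + a * u = d * (a * u)" using d
      by (metis Suc_pred' add.commute mult.commute mult_Suc diff_Suc_1)
    have "x + k * u * (d - 1) * a + d * (v * k) = k * (a * u * (d - 1) + (d * v + gcd a d))"
      using k by (simp add: algebra_simps)
    also have "\<dots> = d * (a * u * k)"
      by (simp only: uv[symmetric] ad) (simp only: ac_simps)
    finally have "d dvd x + k * u * (d - 1) * a"
      by (metis dvd_add_left_iff dvd_triv_left)
    then show ?thesis by blast
  qed
  then obtain t where t: "d dvd x + t * a" by blast
  define q where "q = c a + 1"
  define s where "s = t mod q"
  have dq: "d dvd q * a" using assms(5) unfolding d_def q_def .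
  have "x + t * a = x + s * a + (t div q) * (q * a)"
    unfolding s_def by (metis add.assoc add.commute add_mult_distrib div_mult_mod_eq mult.assoc)
  then have ds: "d dvd x + s * a" using t dq by (metis dvd_add_left_iff dvd_mult)
  \<comment> \<open>\<open>e\<close> is the residue of \<open>- s\<close>; a large multiple of \<open>e * a\<close> keeps the subtraction of \<open>e * a\<close> from \<open>x\<close>
    inside the naturals without changing the class modulo \<open>m\<close>.\<close>
  define e where "e = (q - s) mod q"
  have s: "s < q" unfolding s_def q_def by simp
  have e: "e \<le> c a" unfolding e_def q_def by (metis Suc_eq_plus1 less_Suc_eq_le mod_less_divisor zero_less_Suc)
  have "\<exists>j. s + e = j * q"
    by (cases "s = 0") (use s in \<open>auto simp: e_def intro: exI[of _ 1]\<close>)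
  then obtain j where j: "s + e = j * q" by blast
  have "d dvd (s + e) * a" using dq unfolding j by (simp add: mult.assoc)
  moreover have "d dvd m * e * a" using dm by simp
  ultimately have "d dvd x + s * a + m * e * a - (s + e) * a" 
    using ds by (intro dvd_diff_nat dvd_add[of d "x + s * a"])
  moreover have "x + s * a + m * e * a - (s + e) * a = x + (m - 1) * e * a"
    using mult_pos by (cases m) (auto simp: algebra_simps)
  ultimately have "d dvd x + (m - 1) * e * a" by metis
  then obtain l where l: "\<forall>b\<in>P. l b \<le> c b" "(\<Sum>b\<in>P. l b * b) mod m = (x + (m - 1) * e * a) mod m"
    using assms(3) unfolding filled_def d_def by blast
  let ?l = "l(a := e)"
  have "(\<Sum>b\<in>insert a P. ?l b * b) = e * a + (\<Sum>b\<in>P. ?l b * b)"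
    using finP assms(4) by simp
  also have "(\<Sum>b\<in>P. ?l b * b) = (\<Sum>b\<in>P. l b * b)" using assms(4) by (intro sum.cong) auto
  finally have "(\<Sum>b\<in>insert a P. ?l b * b) mod m = (e * a + (x + (m - 1) * e * a)) mod m"
    by (simp only: mod_add_cong[OF refl l(2)])
  also have "e * a + (x + (m - 1) * e * a) = x + m * (e * a)"
    using mult_pos by (cases m) (auto simp: algebra_simps)
  finally have "(\<Sum>b\<in>insert a P. ?l b * b) mod m = x mod m" by simp
  then show "\<exists>l. (\<forall>b\<in>insert a P. l b \<le> c b) \<and> (\<Sum>b\<in>insert a P. l b * b) mod m = x mod m"
    using l(1) e by (intro exI[of _ ?l]) auto
qed

text \<open>If the gcd is \<open>1\<close>, any remaining generator works. Otherwise
  \<open>cyclic_factorisation\<close> supplies one that the gcd does not divide, hence one outside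
  \<open>P\<close>.\<close>

lemma ex_next:
  assumes "P \<subseteq> M" "m \<in> P" "P \<noteq> M"
  shows "\<exists>a\<in>M - P. Gcd P dvd (c a + 1) * a"
proof (cases "Gcd P = 1")
  case True
  then show ?thesis using assms by auto
next
  case False
  have dm: "Gcd P dvd m" using assms(2) by (rule Gcd_dvd)
  then have "Gcd P \<noteq> 0" using mult_pos by (metis dvd_0_left less_irrefl)
  then have "Gcd P > 1" using False by linarith
  then obtain a where "a \<in> M" "\<not> Gcd P dvd a" "Gcd P dvd (c a + 1) * a"
    using cyclic_factorisation[OF finite_mingens mult_pos dm _ box_bij] by blast
  then show ?thesis using Gcd_dvd by blast
qed

text \<open>Greedy extension of \<open>[m]\<close> by \<open>ex_next\<close>. The invariant
  \<open>filled\<close> upgrades each divisibility to membership in the semigroup of the earlier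
  generators.\<close>

lemma ex_ordering:
  "\<exists>ns. distinct ns \<and> set ns = M \<and> ns \<noteq> [] \<and> ns ! 0 = m \<and>
     (\<forall>i\<in>{1..<length ns}. (c (ns ! i) + 1) * ns ! i \<in> gen_by (set (take i ns)))"
proof -
  have "\<exists>ns. length ns = Suc k \<and> distinct ns \<and> set ns \<subseteq> M \<and> ns ! 0 = m \<and> filled (set ns) \<and>
     (\<forall>i\<in>{1..<length ns}. (c (ns ! i) + 1) * ns ! i \<in> gen_by (set (take i ns)))"
    if "Suc k \<le> card M" for k
    using that
  proof (induction k)
    case 0
    have "filled {m}" unfolding filled_def by (auto intro!: exI[of _ "\<lambda>_. 0"])
    then show ?case using mult_mingens by (intro exI[of _ "[m]"]) auto
  next
    case (Suc k)
    then obtain ns where ns: "length ns = Suc k" "distinct ns" "set ns \<subseteq> M" "ns ! 0 = m" "filled (set ns)"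
      "\<forall>i\<in>{1..<length ns}. (c (ns ! i) + 1) * ns ! i \<in> gen_by (set (take i ns))"
      by auto
    have mns: "m \<in> set ns" using ns(1,4) by (metis nth_mem zero_less_Suc)
    have "set ns \<noteq> M" using Suc.prems ns(1,2) distinct_card[of ns] by auto
    then obtain a where a: "a \<in> M - set ns" "Gcd (set ns) dvd (c a + 1) * a"
      using ex_next ns(3) mns by blast
    have "(c a + 1) * a \<in> S" using a(1) mingens_mem mult_mem by blast
    then have mem: "(c a + 1) * a \<in> gen_by (set ns)"
      using filled_mem_gen_by ns(3,5) mns a(2) by blast
    have "filled (insert a (set ns))" using filled_insert ns(3,5) mns a by blast
    moreover have "(c ((ns @ [a]) ! i) + 1) * (ns @ [a]) ! i \<in> gen_by (set (take i (ns @ [a])))"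
      if "i \<in> {1..<length (ns @ [a])}" for i
      using that ns(6) mem by (cases "i = length ns") (auto simp: nth_append)
    moreover have "(ns @ [a]) ! 0 = m" using ns(1,4) by (simp add: nth_append)
    ultimately show ?case using ns(1,2,3) a
      by (intro exI[of _ "ns @ [a]"]) auto
  qed
  note * = this
  have "card M > 0" using finite_mingens mingens_nonempty by (simp add: card_gt_0_iff)
  then obtain ns where ns: "length ns = card M" "distinct ns" "set ns \<subseteq> M" "ns ! 0 = m"
    "\<forall>i\<in>{1..<length ns}. (c (ns ! i) + 1) * ns ! i \<in> gen_by (set (take i ns))"
    using *[of "card M - 1"] by auto
  have "set ns = M"
    using ns(1-3) finite_mingens distinct_card[of ns] by (intro card_subset_eq) auto
  then show ?thesis using ns \<open>card M > 0\<close> by (intro exI[of _ ns]) auto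
qed

end

section \<open>Freeness\<close>

text \<open>From the last generator down, each coefficient is reduced modulo the least
  \<open>h\<close> for which \<open>h * ns ! k\<close> lies in the earlier semigroup, which absorbs
  the rest. Only the first coefficient stays unbounded.\<close>

lemma phi_reduction:
  assumes "distinct ns" "1 \<le> k" "k \<le> length ns" "x \<in> gen_by (set (take k ns))"
    and "\<And>i. i \<in> {1..<length ns} \<Longrightarrow> \<exists>h>0. h * ns ! i \<in> gen_by (set (take i ns))"
  shows "\<exists>t l. (\<forall>i\<in>{1..<k}. l i \<le> phi ns i) \<and> x = t * ns ! 0 + (\<Sum>i\<in>{1..<k}. l i * ns ! i)"
  using assms(2-4)
proof (induction k arbitrary: x rule: dec_induct)
  case base
  then have "set (take 1 ns) = {ns ! 0}" by (cases ns) auto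
  then show ?case using base unfolding gen_by_def by auto
next
  case (step k)
  have k: "k < length ns" using step.prems by simp
  have tk: "set (take (Suc k) ns) = insert (ns ! k) (set (take k ns))"
    using k by (simp add: take_Suc_conv_app_nth)
  have "ns ! k \<notin> set (take k ns)"
    using assms(1) k by (auto simp: in_set_conv_nth nth_eq_iff_index_eq)
  then obtain a y where y: "y \<in> gen_by (set (take k ns))" "x = a * ns ! k + y"
    using step.prems(2) gen_by_insert[of "set (take k ns)"] unfolding tk by auto
  define h where "h = (LEAST h. h > 0 \<and> h * ns ! k \<in> gen_by (set (take k ns)))"
  have h: "h > 0" "h * ns ! k \<in> gen_by (set (take k ns))"
    using LeastI_ex[of "\<lambda>h. h > 0 \<and> h * ns ! k \<in> gen_by (set (take k ns))"] assms(5)[of k] k step.hyps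
    unfolding h_def by auto
  have phi: "phi ns k = h - 1" unfolding phi_def h_def ..
  have "(a div h) * (h * ns ! k) + y \<in> gen_by (set (take k ns))"
    using h y gen_by_add gen_by_mult by blast
  then obtain t l where tl: "\<forall>i\<in>{1..<k}. l i \<le> phi ns i"
    "(a div h) * (h * ns ! k) + y = t * ns ! 0 + (\<Sum>i\<in>{1..<k}. l i * ns ! i)"
    using step.IH[of "(a div h) * (h * ns ! k) + y"] k by auto
  have "a * ns ! k = (a div h) * (h * ns ! k) + (a mod h) * ns ! k"
    by (metis add_mult_distrib div_mult_mod_eq mult.assoc)
  then have "x = t * ns ! 0 + ((\<Sum>i\<in>{1..<k}. l i * ns ! i) + (a mod h) * ns ! k)"
    using y(2) tl(2) by simp
  also have "(\<Sum>i\<in>{1..<k}. l i * ns ! i) = (\<Sum>i\<in>{1..<k}. (l(k := a mod h)) i * ns ! i)"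
    by (intro sum.cong) auto
  also have "(\<Sum>i\<in>{1..<k}. (l(k := a mod h)) i * ns ! i) + (a mod h) * ns ! k
      = (\<Sum>i\<in>{1..<Suc k}. (l(k := a mod h)) i * ns ! i)"
    using step.hyps by simp
  finally have "x = t * ns ! 0 + (\<Sum>i\<in>{1..<Suc k}. (l(k := a mod h)) i * ns ! i)" .
  \<comment> \<open>The largest remainder is \<open>h - 1\<close>, which is why \<open>phi\<close>
    subtracts one.\<close>
  moreover have "a mod h < h" using h(1) by simp
  then have "a mod h \<le> phi ns k" unfolding phi by linarith
  then have "\<forall>i\<in>{1..<Suc k}. (l(k := a mod h)) i \<le> phi ns i" using tl(1) by auto
  ultimately show ?case by blast
qed

theorem (in rectangular) free: "free S"
proof -
  obtain ns where ns: "distinct ns" "set ns = M" "ns \<noteq> []" "ns ! 0 = m"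
    "\<And>i. i \<in> {1..<length ns} \<Longrightarrow> (c (ns ! i) + 1) * ns ! i \<in> gen_by (set (take i ns))"
    using ex_ordering by blast
  have phi_le: "phi ns i \<le> c (ns ! i)" if "i \<in> {1..<length ns}" for i
    using Least_le[of "\<lambda>h. h > 0 \<and> h * ns ! i \<in> gen_by (set (take i ns))" "c (ns ! i) + 1"] ns(5)[OF that]
    unfolding phi_def by simp
  have ex: "\<exists>h>0. h * ns ! i \<in> gen_by (set (take i ns))" if "i \<in> {1..<length ns}" for i
    using ns(5)[OF that] by (intro exI[of _ "c (ns ! i) + 1"]) simp
  have memM: "ns ! i \<in> M" if "i < length ns" for i using ns(2) that nth_mem by blast
  have "Apery S m = {(\<Sum>i\<in>{1..<length ns}. l i * ns ! i) | l. \<forall>i\<in>{1..<length ns}. l i \<le> phi ns i}"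
    (is "_ = ?R")
  proof (intro equalityI subsetI)
    fix x assume "x \<in> Apery S m"
    then have x: "x \<in> Ap S" unfolding Ap_def .
    have "x \<in> gen_by (set (take (length ns) ns))" using ex_rep Ap_mem x ns(2) by simp
    moreover have "1 \<le> length ns" using ns(3) by (cases ns) auto
    ultimately obtain t l where tl: "\<forall>i\<in>{1..<length ns}. l i \<le> phi ns i"
      "x = t * m + (\<Sum>i\<in>{1..<length ns}. l i * ns ! i)"
      using phi_reduction[OF ns(1) _ order_refl _ ex, of x] ns(4) by auto
    have "(\<Sum>i\<in>{1..<length ns}. l i * ns ! i) \<in> S"
    proof -
      have "(\<Sum>i\<in>I. l i * ns ! i) \<in> S" if "I \<subseteq> {1..<length ns}" for I
        using that by (induction I rule: infinite_finite_induct)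
          (auto simp: zero_mem intro!: add_mem mult_mem mingens_mem[OF memM])
      then show ?thesis by blast
    qed
    \<comment> \<open>For \<open>t > 0\<close>, a copy of \<open>m\<close> could be split off the
      Apery element \<open>x\<close>.\<close>
    then have "t = 0" using x tl(2) not_in_Ap[of "(t - 1) * m + (\<Sum>i\<in>{1..<length ns}. l i * ns ! i)"]
      add_mem mult_mem mult_mingens mingens_mem by (cases t) (auto simp: add.assoc)
    then show "x \<in> ?R" using tl by auto
  next
    fix x assume "x \<in> ?R"
    then obtain l where l: "\<forall>i\<in>{1..<length ns}. l i \<le> phi ns i"
      "x = (\<Sum>i\<in>{1..<length ns}. l i * ns ! i)" by blast
    define I where "I = {1..<length ns}"
    \<comment> \<open>Passes from coefficients indexed by positions in \<open>ns\<close> to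
      coefficients indexed by generators.\<close>
    define l' where "l' a = l (inv_into I ((!) ns) a)" for a
    have inj: "inj_on ((!) ns) I" unfolding I_def using ns(1) by (intro inj_on_nth) auto
    have l': "l' (ns ! i) = l i" if "i \<in> I" for i
      unfolding l'_def using inv_into_f_f[OF inj that] by simp
    have "x = (\<Sum>a\<in>(!) ns ` I. l' a * a)"
      unfolding l(2) I_def[symmetric] using l' by (simp add: sum.reindex[OF inj])
    moreover have "(\<Sum>a\<in>(!) ns ` I. l' a * a) \<in> Ap S"
      using l(1) l' phi_le memM by (intro face_mem_Ap) (force simp: I_def)+
    ultimately show "x \<in> Apery S m" unfolding Ap_def by simp
  qed
  then show ?thesis
    unfolding free_def by (intro exI[of _ ns] conjI) (simp_all only: ns(1,2,4))
qed

section \<open>The semigroup generated by 5, 6 and 9\<close>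

text \<open>Splitting a generator \<open>b\<close> off a representation leaves an element of
  \<open>S\<close>, which must be \<open>0\<close> since \<open>a\<close> is indecomposable.\<close>

lemma (in numsgp) is_rep_mingen_iff:
  assumes a: "a \<in> M"
  shows "is_rep S a f \<longleftrightarrow> f = (\<lambda>x. if x = a then 1 else 0)"
proof
  assume f: "is_rep S a f"
  then have s: "a = (\<Sum>x\<in>M. f x * x)" unfolding is_rep_def by blast
  have "\<exists>b\<in>M. f b \<noteq> 0"
  proof (rule ccontr)
    assume "\<not> (\<exists>b\<in>M. f b \<noteq> 0)"
    then have "(\<Sum>x\<in>M. f x * x) = 0" by simp
    then show False using s mingens_pos[OF a] by linarith
  qed
  then obtain b where b: "b \<in> M" "1 \<le> f b" by force
  define r where "r x = f x - (if x = b then 1 else 0)" for x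
  have eq: "a = (\<Sum>x\<in>M. r x * x) + b"
    using sum_split_multiple[of M b 1 f "\<lambda>x. x"] finite_mingens b s unfolding r_def by simp
  have "(\<Sum>x\<in>M. r x * x) \<in> S" using sum_mem mingens_mem by blast
  then have z: "(\<Sum>x\<in>M. r x * x) = 0"
    using a eq b(1) mingens_mem[of b] mingens_pos[of b] unfolding mingens_def by blast
  then have "\<forall>x\<in>M. r x = 0" using finite_mingens mingens_pos by auto
  moreover have ab: "a = b" using eq z by simp
  ultimately have "f x - (if x = a then 1 else 0) = 0" if "x \<in> M" for x
    using that unfolding r_def ab by blast
  then have fx: "f x = (if x = a then 1 else 0)" if "x \<in> M" for x
    using that b(2) ab by (cases "x = a") force+
  show "f = (\<lambda>x. if x = a then 1 else 0)"
  proof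
    fix x
    show "f x = (if x = a then 1 else 0)"
      by (cases "x \<in> M") (use fx f a in \<open>auto simp: is_rep_def\<close>)
  qed
qed (use is_rep_single[OF a, of 1] in simp)

text \<open>The value \<open>h = 1\<close> qualifies: \<open>a\<close> has only the trivial
  representation, and \<open>a - m\<close> in \<open>S\<close> would decompose
  \<open>a\<close>.\<close>

lemma (in numsgp) gamma_pos:
  assumes a: "a \<in> M" "a \<noteq> m"
  shows "1 \<le> gamma S a"
proof -
  have ord: "ord S a = 1"
    unfolding ord_def using is_rep_mingen_iff[OF a(1)] degree_single[OF a(1), of 1] by simp
  have "\<not> (m \<le> a \<and> a - m \<in> S)"
  proof
    assume h: "m \<le> a \<and> a - m \<in> S"
    then show False
      using sum_notin_mingens[of m "a - m"] a mult_pos mult_mingens mingens_mem by simp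
  qed
  then have "a \<in> Ap S" using mingens_mem[OF a(1)] unfolding Ap_def Apery_def by blast
  moreover have "\<exists>!f. is_maxrep S a f"
    unfolding is_maxrep_def using is_rep_mingen_iff[OF a(1)] degree_single[OF a(1), of 1] ord by auto
  ultimately show ?thesis using le_gamma[OF a(1), of 1] ord by simp
qed

lemma gen_569: "x \<in> gen_by {5, 6, 9} \<longleftrightarrow> x \<notin> {1, 2, 3, 4, 7, 8, 13}"
proof -
  have "x \<in> gen_by {5, 6, 9} \<longleftrightarrow> (\<exists>i j k. x = 5 * i + (6 * j + 9 * k))"
  proof
    assume "x \<in> gen_by {5, 6, 9}"
    then obtain f where "x = (\<Sum>a\<in>{5, 6, 9}. f a * a)" unfolding gen_by_def by blast
    then have "x = 5 * f 5 + (6 * f 6 + 9 * f 9)" by simp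
    then show "\<exists>i j k. x = 5 * i + (6 * j + 9 * k)" by blast
  next
    assume "\<exists>i j k. x = 5 * i + (6 * j + 9 * k)"
    then obtain i j k where "x = 5 * i + (6 * j + 9 * k)" by blast
    then show "x \<in> gen_by {5, 6, 9}"
      using gen_byI[of "\<lambda>a. if a = 5 then i else if a = 6 then j else k" "{5, 6, 9}"]
      by (simp add: mult.commute)
  qed
  also have "\<dots> \<longleftrightarrow> x \<notin> {1, 2, 3, 4, 7, 8, 13}"
  proof
    assume "\<exists>i j k. x = 5 * i + (6 * j + 9 * k)"
    then show "x \<notin> {1, 2, 3, 4, 7, 8, 13}" by auto presburger+
  next
    assume "x \<notin> {1, 2, 3, 4, 7, 8, 13}"
    \<comment> \<open>The offsets \<open>0, 6, 12, 18, 9\<close> are the least elements of the five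
      classes modulo \<open>5\<close>.\<close>
    then have "(\<exists>i. x = 5 * i) \<or> (\<exists>i. x = 5 * i + 6) \<or> (\<exists>i. x = 5 * i + 12) \<or> (\<exists>i. x = 5 * i + 18) \<or> (\<exists>i. x = 5 * i + 9)"
      by simp presburger
    then show "\<exists>i j k. x = 5 * i + (6 * j + 9 * k)"
    proof (elim disjE exE)
      fix i assume "x = 5 * i"
      then show ?thesis by (intro exI[of _ i] exI[of _ 0]) simp
    next
      fix i assume "x = 5 * i + 6"
      then show ?thesis by (intro exI[of _ i] exI[of _ 1] exI[of _ 0]) simp
    next
      fix i assume "x = 5 * i + 12"
      then show ?thesis by (intro exI[of _ i] exI[of _ 2] exI[of _ 0]) simp
    next
      fix i assume "x = 5 * i + 18"
      then show ?thesis by (intro exI[of _ i] exI[of _ 3] exI[of _ 0]) simp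
    next
      fix i assume "x = 5 * i + 9"
      then show ?thesis by (intro exI[of _ i] exI[of _ 0] exI[of _ 1]) simp
    qed
  qed
  finally show ?thesis .
qed

lemma numerical_semigroup_569: "numerical_semigroup (gen_by {5, 6, 9})"
proof -
  have "UNIV - gen_by {5, 6, 9} \<subseteq> {1, 2, 3, 4, 7, 8, 13}" using gen_569 by auto
  then show ?thesis
    unfolding numerical_semigroup_def using gen_by_zero gen_by_add
    by (auto intro: finite_subset)
qed

lemma mingens_569: "mingens (gen_by {5, 6, 9}) = {5, 6, 9}"
proof (intro equalityI subsetI)
  interpret numsgp "gen_by {5, 6, 9}" by standard (rule numerical_semigroup_569)
  fix x assume x: "x \<in> mingens (gen_by {5, 6, 9})"
  then have xS: "x \<in> gen_by {5, 6, 9}" "x \<noteq> 0" unfolding mingens_def by auto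
  have diff: "\<not> (a \<le> x \<and> x \<noteq> a \<and> x - a \<in> gen_by {5, 6, 9})" if "a \<in> {5, 6, 9}" for a
  proof
    assume h: "a \<le> x \<and> x \<noteq> a \<and> x - a \<in> gen_by {5, 6, 9}"
    have "a \<noteq> 0" "a \<in> gen_by {5, 6, 9}" using that unfolding gen_569 by auto
    then show False using sum_notin_mingens[of a "x - a"] x h by simp
  qed
  \<comment> \<open>For \<open>x \<ge> 10\<close>, the number \<open>x - 5\<close> is a gap only if
    it is \<open>7\<close>, \<open>8\<close> or \<open>13\<close>; otherwise \<open>x\<close>
    decomposes.\<close>
  have "x < 10 \<or> x \<in> {12, 13, 18}"
  proof (rule ccontr)
    assume "\<not> (x < 10 \<or> x \<in> {12, 13, 18})"
    then have "5 \<le> x \<and> x \<noteq> 5 \<and> x - 5 \<in> gen_by {5, 6, 9}" unfolding gen_569 by auto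
    then show False using diff[of 5] by blast
  qed
  moreover have "x \<notin> {12, 13, 18}" using xS diff[of 6] unfolding gen_569 by auto
  moreover have "x \<in> {5, 6, 9}" if "x < 10"
    using xS that unfolding gen_569 by simp linarith
  ultimately show "x \<in> {5, 6, 9}" by blast
next
  fix x :: nat assume "x \<in> {5, 6, 9}"
  \<comment> \<open>Sums of two nonzero elements are at least \<open>10\<close>, too large for
    \<open>5\<close>, \<open>6\<close> and \<open>9\<close>.\<close>
  moreover have "5 \<le> a" if "a \<in> gen_by {5, 6, 9}" "a \<noteq> 0" for a
    using that unfolding gen_569 by simp
  then have "10 \<le> a + b"
    if "a \<in> gen_by {5, 6, 9}" "a \<noteq> 0" "b \<in> gen_by {5, 6, 9}" "b \<noteq> 0" for a b
    using that by (metis add_mono numeral_Bit0)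
  ultimately show "x \<in> mingens (gen_by {5, 6, 9})"
    unfolding mingens_def by (force simp: gen_569)
qed

lemma gen_by_6: "x \<in> gen_by {6} \<longleftrightarrow> 6 dvd x"
  unfolding gen_by_def by (auto intro: exI[of _ "\<lambda>_. x div 6"])

lemma gen_by_69: "x \<in> gen_by {6, 9} \<longleftrightarrow> (\<exists>k. x = 6 * k) \<or> (\<exists>k. x = 6 * k + 9)"
proof -
  have "x \<in> gen_by {6, 9} \<longleftrightarrow> (\<exists>k y. 6 dvd y \<and> x = k * 9 + y)"
    using gen_by_insert[of "{6}" 9 x] gen_by_6 by (auto simp: insert_commute)
  also have "\<dots> \<longleftrightarrow> (\<exists>k. x = 6 * k) \<or> (\<exists>k. x = 6 * k + 9)" by presburger
  finally show ?thesis .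
qed

lemma free_569: "free (gen_by {5, 6, 9})"
proof -
  \<comment> \<open>The ordering starts with \<open>6\<close>, not with the multiplicity
    \<open>5\<close>. The relations \<open>2 * 9 = 3 * 6\<close> and \<open>3 * 5 = 6 + 9\<close>
    give the bounds \<open>1\<close> and \<open>2\<close>, and the six box sums are the Apery set of
    \<open>6\<close>.\<close>
  let ?ns = "[6, 9, 5] :: nat list"
  have "(LEAST h. h > 0 \<and> h * 9 \<in> gen_by {6}) = 2"
    unfolding gen_by_6 by (rule Least_equality) presburger+
  then have phi1: "phi ?ns 1 = 1" unfolding phi_def by simp
  have "(LEAST h. h > 0 \<and> h * 5 \<in> gen_by {6, 9}) = 3"
    unfolding gen_by_69 by (rule Least_equality) presburger+
  then have phi2: "phi ?ns 2 = 2" unfolding phi_def by (simp add: numeral_2_eq_2 insert_commute)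
  have I: "{1..<length ?ns} = {1, 2}" by auto
  have "Apery (gen_by {5, 6, 9}) 6 = {0, 5, 10, 9, 14, 19}"
    unfolding Apery_def gen_569 by (simp add: set_eq_iff) presburger
  also have "\<dots> = {(\<Sum>i\<in>{1..<length ?ns}. l i * ?ns ! i) | l. \<forall>i\<in>{1..<length ?ns}. l i \<le> phi ?ns i}"
    (is "_ = ?R")
  proof -
    have R: "?R = {l 1 * 9 + l 2 * 5 | l. l 1 \<le> 1 \<and> l (2::nat) \<le> (2::nat)}"
      unfolding I using phi1 phi2 by simp
    have mem: "x * 9 + y * 5 \<in> ?R" if "x \<le> 1" "y \<le> 2" for x y
      unfolding R using that by (intro CollectI exI[of _ "\<lambda>i. if i = 1 then x else y"]) simp
    show ?thesis
    proof (intro equalityI subsetI)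
      fix z :: nat assume "z \<in> {0, 5, 10, 9, 14, 19}"
      then show "z \<in> ?R"
        using mem[of 0 0] mem[of 0 1] mem[of 0 2] mem[of 1 0] mem[of 1 1] mem[of 1 2] by auto
    next
      fix z assume "z \<in> ?R"
      then obtain x y where "z = x * 9 + y * 5" "x \<le> 1" "y \<le> (2::nat)" unfolding R by blast
      moreover from this have "x = 0 \<or> x = 1" "y = 0 \<or> y = 1 \<or> y = 2" by auto
      ultimately show "z \<in> {0, 5, 10, 9, 14, 19}" by auto
    qed
  qed
  finally show ?thesis
    unfolding free_def using mingens_569 by (intro exI[of _ ?ns]) (auto simp: insert_commute)
qed

text \<open>Both \<open>gamma\<close> values are at least \<open>1\<close>, so the box would contain
  \<open>6 + 9 = 15\<close>; but \<open>15 - 5 = 10\<close> lies in the semigroup.\<close>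

lemma not_gamma_rectangular_569: "\<not> gamma_rectangular (gen_by {5, 6, 9})"
proof
  let ?S = "gen_by {5, 6, 9}"
  assume rect: "gamma_rectangular ?S"
  interpret numsgp ?S by standard (rule numerical_semigroup_569)
  have m: "mult ?S = 5" unfolding mult_def mingens_569 by simp
  have g: "1 \<le> gamma ?S 6" "1 \<le> gamma ?S 9"
    using gamma_pos[of 6] gamma_pos[of 9] unfolding m mingens_569 by auto
  have M: "mingens ?S - {mult ?S} = {6, 9}" unfolding m mingens_569 by auto
  have "(\<Sum>a\<in>{6, 9}. 1 * a) \<in> Ap ?S"
    using rect g unfolding gamma_rectangular_def M by (auto intro!: exI[of _ "\<lambda>_. 1"])
  then have "15 \<in> Ap ?S" by simp
  then show False unfolding Ap_def Apery_def m gen_569 by simp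
qed

theorem mainTheorem8:
  shows "(\<forall>S. numerical_semigroup S \<longrightarrow> gamma_rectangular S \<longrightarrow> free S)
       \<and> numerical_semigroup (gen_by {5, 6, 9})
       \<and> free (gen_by {5, 6, 9})
       \<and> \<not> gamma_rectangular (gen_by {5, 6, 9})"
  using rectangular.free numerical_semigroup_569 free_569 not_gamma_rectangular_569
  by (simp add: rectangular_def rectangular_axioms_def numsgp_def)

end
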